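(* Let $(x_k)_{k\ge0}$ be generated by algorithm CPG or CGD (see context) under the assumptions stated there, with $i_k$ chosen cyclically. Assume that for some constant $C>0$, $$F(x_k)-F(x_{k+N})\ge C\|\nabla F(x_k)\|^2\qquad\forall k\ge0,$$ that $F$ is convex, and that $R:=\max_{k\ge0}\min_{x^*\in X^*}\|x_k-x^*\|<\infty$, where $X^*$ is the set of minimizers of $F$. Then for all $k\ge0$ and $x^*\in X^*$, $$F(x_{kN})-F(x^* )\le\frac{(F(x_0)-F(x^* ))\,R^2}{C\,(F(x_0)-F(x^* ))\,k+R^2}.$$
   Context: Setting: $F=f+\psi$ with $f,\psi:\mathbb{R}^n\to\mathbb{R}$, $f$ differentiable ($f$ and $\psi$ need not be separately convex). $U=[U_1,\dots,U_N]\in\mathbb{R}^{n\times n}$ is a column permutation of $I_n$, split into $U_i\in\mathbb{R}^{n\times n_i}$, $\sum_i n_i=n$. Norms are Euclidean / induced operator norms. Cyclic choice: $i_k=(k\bmod N)+1$. Assumptions. A.1: $\|U_i^T(\nabla f(x+U_ih)-\nabla f(x))\|\le L_i\|h\|$ for all $h,x,i$. A.2: $\psi$ is twice continuously differentiable. A.3: $F$ attains its minimum $F^*>-\infty$. Algorithm CPG: fix $\eta_i>0$; $H_{f,U_i}=\frac{L_i+\eta_i}{2}$ if $d\mapsto\psi(x+U_id)$ is convex for all $x,i$, else $H_{f,U_i}=L_i+\eta_i$. Given $x_0$, for $k\ge0$: choose $i_k$; take $d_k\in\arg\min_{d\in\mathbb{R}^{n_{i_k}}}f(x_k)+\langle U_{i_k}^T\nabla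 f(x_k),d\rangle+\frac{H_{f,U_{i_k}}}{2}\|d\|^2+\psi(x_k+U_{i_k}d)$ (assumed to exist); $x_{k+1}=x_k+U_{i_k}d_k$. Algorithm CGD: fix $\eta_i>0$; $H_{f,U_i}=\frac{L_i+\eta_i}{2}$. Given $x_0$, for $k\ge0$: choose $i_k$, compute $H_{F_k}$ by one of the rules below, $d_k=-\frac1{H_{F_k}}U_{i_k}^T\nabla F(x_k)$, $x_{k+1}=x_k+U_{i_k}d_k$. The same rule is used for all $k$, and $\psi$ satisfies the assumption attached to it: Rule 1 (A.4 and A.5): $\alpha_k\ge0$ root of $\frac{L_\psi}{6}\alpha^2+(\frac{H_\psi}{2}\|x_k\|^p+H_{f,U_{i_k}})\alpha=\|U_{i_k}^T\nabla F(x_k)\|$; $H_{F_k}=\frac{H_\psi}{2}\|x_k\|^p+\frac{L_\psi}{6}\alpha_k+H_{f,U_{i_k}}$. Rule 2 (A.4): $\alpha_k\ge0$ root of $2^{p-1}H_\psi\alpha^{p+1}+(2^{p-1}H_\psi\|x_k\|^p+H_{f,U_{i_k}})\alpha=\|U_{i_k}^T\nabla F(x_k)\|$; $H_{F_k}=2^{p-1}H_\psi\|x_k\|^p+2^{p-1}H_\psi\alpha_k^p+H_{f,U_{i_k}}$. Rule 3 (A.5): $\alpha_k\ge0$ root of $\frac{L_\psi}{6}\alpha^2+(\frac{L_\psi}{2}\|x_k-x_0\|+\frac12\|\nabla^2\psi(x_0)\|+H_{f,U_{i_k}})\alpha=\|U_{i_k}^T\nabla F(x_k)\|$; $H_{F_k}=\frac{L_\psi}{2}\|x_k-x_0\|+\frac12\|\nabla^2\psi(x_0)\|+\frac{L_\psi}{6}\alpha_k+H_{f,U_{i_k}}$.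 Rule 4 (A.6): $H_{F_k}=H_{f,U_{i_k}}$. Here A.4: $\|U_i^T\nabla^2\psi(y)U_i\|\le H_\psi\|y\|^p$ for all $y,i$ ($H_\psi>0$, integer $p\ge1$); A.5: $\|\nabla^2\psi(y)-\nabla^2\psi(x)\|\le L_\psi\|y-x\|$ for all $x,y$ ($L_\psi>0$); A.6: $\psi(x+U_id)\le\psi(x)+\langle U_i^T\nabla\psi(x),d\rangle$ for all $x,d,i$. *)

theory Defs
  imports "HOL-Analysis.Analysis"
begin

section \<open>Gradient, Hessian, minimizers\<close>

definition grad :: "('a::euclidean_space \<Rightarrow> real) \<Rightarrow> 'a \<Rightarrow> 'a" where
  "grad f x = (THE D. GDERIV f x :> D)"

lemma grad_GDERIV:
  fixes f :: "'a::euclidean_space \<Rightarrow> real"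
  assumes "f differentiable (at x)"
  shows "GDERIV f x :> grad f x"
proof -
  obtain f' where f': "(f has_derivative f') (at x)"
    using assms by (auto simp: differentiable_def)
  interpret linear f'
    using f' by (rule has_derivative_linear)
  define D where "D = (\<Sum>b\<in>Basis. f' b *\<^sub>R b)"
  have "f' h = h \<bullet> D" for h
  proof -
    have "f' h = f' (\<Sum>b\<in>Basis. (h \<bullet> b) *\<^sub>R b)"
      by (simp add: euclidean_representation)
    also have "\<dots> = h \<bullet> D"
      by (simp add: D_def sum scale inner_sum_right mult.commute)
    finally show ?thesis .
  qed
  then have "f' = (\<lambda>h. h \<bullet> D)"
    by blast
  then have "GDERIV f x :> D"
    using f' by (simp add: gderiv_def)
  moreover have "D' = D" if "GDERIV f x :> D'" for D'
  proof -
    have "(\<lambda>h. h \<bullet> D') = (\<lambda>h. h \<bullet> D)"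
      using that \<open>GDERIV f x :> D\<close> unfolding gderiv_def by (rule has_derivative_unique)
    then show ?thesis
      by (metis vector_eq_rdot inner_commute)
  qed
  ultimately show ?thesis
    unfolding grad_def by (metis theI)
qed

definition hessian :: "(real^'n \<Rightarrow> real) \<Rightarrow> real^'n \<Rightarrow> real^'n^'n" where
  "hessian f x = jacobian (grad f) (at x)"

definition twice_cont_differentiable :: "(real^'n \<Rightarrow> real) \<Rightarrow> bool" where
  "twice_cont_differentiable f \<longleftrightarrow>
     (\<forall>x. f differentiable (at x)) \<and> (\<forall>x. grad f differentiable (at x)) \<and>
     continuous_on UNIV (hessian f)"

definition minimizers :: "('a \<Rightarrow> real) \<Rightarrow> 'a set" where
  "minimizers F = {y. is_arg_min F (\<lambda>_. True) y}"


section \<open>Column blocks of a permuted identity matrix\<close>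

text \<open>
  The matrix U = [U_1, ..., U_N] is given by its columns: U i j is column j (with j < m i,
  counting from 0) of the n-by-(m i) block U_i, for i in {1..N}. As the m i vary with i, the space
  of real (m i)-vectors is represented by functions of type nat => real of which only the entries
  below m i are ever used. The bijection below says that U is a column permutation of the identity;
  in particular the m i sum up to n.
\<close>

definition identity_blocks :: "nat \<Rightarrow> (nat \<Rightarrow> nat) \<Rightarrow> (nat \<Rightarrow> nat \<Rightarrow> real^'n) \<Rightarrow> bool" where
  "identity_blocks N m U \<longleftrightarrow>
     bij_betw (\<lambda>(i, j). U i j) (SIGMA i:{1..N}. {..<m i}) (columns (mat 1 :: real^'n^'n))"

lemma identity_blocks_sum:
  assumes "identity_blocks N m (U :: nat \<Rightarrow> nat \<Rightarrow> real^'n)"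
  shows "(\<Sum>i=1..N. m i) = CARD('n)"
proof -
  have "columns (mat 1 :: real^'n^'n) = range (\<lambda>a. axis a 1)"
    by (auto simp: columns_def column_def mat_def axis_def image_def)
  moreover have "inj (\<lambda>a::'n. axis a (1::real))"
    by (auto simp: inj_def axis_eq_axis)
  ultimately have "card (columns (mat 1 :: real^'n^'n)) = CARD('n)"
    by (simp add: card_image)
  then show ?thesis
    using bij_betw_same_card[OF assms[unfolded identity_blocks_def]] by simp
qed

text \<open>The products of U_i with h and of the transpose of U_i with v.\<close>

definition blk :: "(nat \<Rightarrow> nat) \<Rightarrow> (nat \<Rightarrow> nat \<Rightarrow> real^'n) \<Rightarrow> nat \<Rightarrow> (nat \<Rightarrow> real) \<Rightarrow> real^'n" where
  "blk m U i h = (\<Sum>j<m i. h j *\<^sub>R U i j)"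

definition blkT :: "(nat \<Rightarrow> nat \<Rightarrow> real^'n) \<Rightarrow> nat \<Rightarrow> real^'n \<Rightarrow> (nat \<Rightarrow> real)" where
  "blkT U i v = (\<lambda>j. U i j \<bullet> v)"

definition vnorm :: "nat \<Rightarrow> (nat \<Rightarrow> real) \<Rightarrow> real" where
  "vnorm n h = L2_set h {..<n}"

definition vinner :: "nat \<Rightarrow> (nat \<Rightarrow> real) \<Rightarrow> (nat \<Rightarrow> real) \<Rightarrow> real" where
  "vinner n g h = (\<Sum>j<n. g j * h j)"

text \<open>Counterpart of onorm for linear maps on n-vectors.\<close>

definition vonorm :: "nat \<Rightarrow> ((nat \<Rightarrow> real) \<Rightarrow> (nat \<Rightarrow> real)) \<Rightarrow> real" where
  "vonorm n A = (SUP h. vnorm n (A h) / vnorm n h)"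


section \<open>Assumptions on f and \<psi>\<close>

definition block_lipschitz_grad ::
  "nat \<Rightarrow> (nat \<Rightarrow> nat) \<Rightarrow> (nat \<Rightarrow> nat \<Rightarrow> real^'n) \<Rightarrow> (nat \<Rightarrow> real) \<Rightarrow> (real^'n \<Rightarrow> real) \<Rightarrow> bool" where
  "block_lipschitz_grad N m U L f \<longleftrightarrow>
     (\<forall>i\<in>{1..N}. \<forall>h x.
        vnorm (m i) (blkT U i (grad f (x + blk m U i h) - grad f x)) \<le> L i * vnorm (m i) h)"

definition block_convex ::
  "nat \<Rightarrow> (nat \<Rightarrow> nat) \<Rightarrow> (nat \<Rightarrow> nat \<Rightarrow> real^'n) \<Rightarrow> (real^'n \<Rightarrow> real) \<Rightarrow> bool" where
  "block_convex N m U \<psi> \<longleftrightarrow>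
     (\<forall>i\<in>{1..N}. \<forall>x d e. \<forall>t\<in>{0..1}.
        \<psi> (x + blk m U i (\<lambda>j. (1 - t) * d j + t * e j))
          \<le> (1 - t) * \<psi> (x + blk m U i d) + t * \<psi> (x + blk m U i e))"

definition block_hessian_growth ::
  "nat \<Rightarrow> (nat \<Rightarrow> nat) \<Rightarrow> (nat \<Rightarrow> nat \<Rightarrow> real^'n) \<Rightarrow> real \<Rightarrow> nat \<Rightarrow> (real^'n \<Rightarrow> real) \<Rightarrow> bool" where
  "block_hessian_growth N m U H p \<psi> \<longleftrightarrow> H > 0 \<and> p \<ge> 1 \<and>
     (\<forall>i\<in>{1..N}. \<forall>y.
        vonorm (m i) (\<lambda>h. blkT U i (hessian \<psi> y *v blk m U i h)) \<le> H * norm y ^ p)"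

definition lipschitz_hessian :: "real \<Rightarrow> (real^'n \<Rightarrow> real) \<Rightarrow> bool" where
  "lipschitz_hessian L \<psi> \<longleftrightarrow> L > 0 \<and>
     (\<forall>x y. onorm (\<lambda>h. (hessian \<psi> y - hessian \<psi> x) *v h) \<le> L * norm (y - x))"

definition block_upper_linear ::
  "nat \<Rightarrow> (nat \<Rightarrow> nat) \<Rightarrow> (nat \<Rightarrow> nat \<Rightarrow> real^'n) \<Rightarrow> (real^'n \<Rightarrow> real) \<Rightarrow> bool" where
  "block_upper_linear N m U \<psi> \<longleftrightarrow>
     (\<forall>i\<in>{1..N}. \<forall>x d.
        \<psi> (x + blk m U i d) \<le> \<psi> x + vinner (m i) (blkT U i (grad \<psi> x)) d)"


section \<open>The algorithms\<close>

definition cyclic_index :: "nat \<Rightarrow> nat \<Rightarrow> nat" where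
  "cyclic_index N k = k mod N + 1"

definition H_cpg ::
  "nat \<Rightarrow> (nat \<Rightarrow> nat) \<Rightarrow> (nat \<Rightarrow> nat \<Rightarrow> real^'n) \<Rightarrow> (nat \<Rightarrow> real) \<Rightarrow> (nat \<Rightarrow> real) \<Rightarrow> (real^'n \<Rightarrow> real)
    \<Rightarrow> nat \<Rightarrow> real" where
  "H_cpg N m U L \<eta> \<psi> i = (if block_convex N m U \<psi> then (L i + \<eta> i) / 2 else L i + \<eta> i)"

definition H_cgd :: "(nat \<Rightarrow> real) \<Rightarrow> (nat \<Rightarrow> real) \<Rightarrow> nat \<Rightarrow> real" where
  "H_cgd L \<eta> i = (L i + \<eta> i) / 2"

definition cpg ::
  "nat \<Rightarrow> (nat \<Rightarrow> nat) \<Rightarrow> (nat \<Rightarrow> nat \<Rightarrow> real^'n) \<Rightarrow> (nat \<Rightarrow> real) \<Rightarrow> (nat \<Rightarrow> real)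
    \<Rightarrow> (real^'n \<Rightarrow> real) \<Rightarrow> (real^'n \<Rightarrow> real) \<Rightarrow> (nat \<Rightarrow> nat) \<Rightarrow> (nat \<Rightarrow> real^'n) \<Rightarrow> bool" where
  "cpg N m U L \<eta> f \<psi> i x \<longleftrightarrow>
     (\<forall>k. \<exists>d.
        is_arg_min
          (\<lambda>d. f (x k) + vinner (m (i k)) (blkT U (i k) (grad f (x k))) d
             + H_cpg N m U L \<eta> \<psi> (i k) / 2 * vnorm (m (i k)) d ^ 2
             + \<psi> (x k + blk m U (i k) d))
          (\<lambda>_. True) d
        \<and> x (Suc k) = x k + blk m U (i k) d)"

text \<open>
  The four rules for the stepsize parameter H: x0 is the starting point, x the current iterate,
  h the constant H_cgd of the current block, and g the norm of the current block of the
  gradient of F.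
\<close>

definition cgd_rule1 :: "real \<Rightarrow> nat \<Rightarrow> real \<Rightarrow> real^'n \<Rightarrow> real \<Rightarrow> real \<Rightarrow> real \<Rightarrow> bool" where
  "cgd_rule1 H\<psi> p L\<psi> x h g H \<longleftrightarrow>
     (\<exists>\<alpha>\<ge>0. L\<psi> / 6 * \<alpha>^2 + (H\<psi> / 2 * norm x ^ p + h) * \<alpha> = g \<and>
        H = H\<psi> / 2 * norm x ^ p + L\<psi> / 6 * \<alpha> + h)"

definition cgd_rule2 :: "real \<Rightarrow> nat \<Rightarrow> real^'n \<Rightarrow> real \<Rightarrow> real \<Rightarrow> real \<Rightarrow> bool" where
  "cgd_rule2 H\<psi> p x h g H \<longleftrightarrow>
     (\<exists>\<alpha>\<ge>0. 2^(p-1) * H\<psi> * \<alpha>^(p+1) + (2^(p-1) * H\<psi> * norm x ^ p + h) * \<alpha> = g \<and>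
        H = 2^(p-1) * H\<psi> * norm x ^ p + 2^(p-1) * H\<psi> * \<alpha>^p + h)"

definition cgd_rule3 ::
  "real \<Rightarrow> (real^'n \<Rightarrow> real) \<Rightarrow> real^'n \<Rightarrow> real^'n \<Rightarrow> real \<Rightarrow> real \<Rightarrow> real \<Rightarrow> bool" where
  "cgd_rule3 L\<psi> \<psi> x0 x h g H \<longleftrightarrow>
     (\<exists>\<alpha>\<ge>0. L\<psi> / 6 * \<alpha>^2
            + (L\<psi> / 2 * norm (x - x0) + 1 / 2 * onorm (\<lambda>v. hessian \<psi> x0 *v v) + h) * \<alpha> = g \<and>
        H = L\<psi> / 2 * norm (x - x0) + 1 / 2 * onorm (\<lambda>v. hessian \<psi> x0 *v v) + L\<psi> / 6 * \<alpha> + h)"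

definition cgd_rule4 :: "real \<Rightarrow> real \<Rightarrow> bool" where
  "cgd_rule4 h H \<longleftrightarrow> H = h"

text \<open>Gradient steps with the parameters H k produced by a rule that maps h and g (as above) to H.\<close>

definition cgd_steps ::
  "(nat \<Rightarrow> nat) \<Rightarrow> (nat \<Rightarrow> nat \<Rightarrow> real^'n) \<Rightarrow> (nat \<Rightarrow> real) \<Rightarrow> (nat \<Rightarrow> real) \<Rightarrow> (real^'n \<Rightarrow> real)
    \<Rightarrow> (nat \<Rightarrow> nat) \<Rightarrow> (nat \<Rightarrow> real^'n) \<Rightarrow> (real^'n \<Rightarrow> real \<Rightarrow> real \<Rightarrow> real \<Rightarrow> bool) \<Rightarrow> bool" where
  "cgd_steps m U L \<eta> F i x rule_H \<longleftrightarrow>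
     (\<forall>k. \<exists>H. rule_H (x k) (H_cgd L \<eta> (i k)) (vnorm (m (i k)) (blkT U (i k) (grad F (x k)))) H \<and>
        x (Suc k) = x k + blk m U (i k) (\<lambda>j. - (1 / H) * blkT U (i k) (grad F (x k)) j))"

definition cgd ::
  "nat \<Rightarrow> (nat \<Rightarrow> nat) \<Rightarrow> (nat \<Rightarrow> nat \<Rightarrow> real^'n) \<Rightarrow> (nat \<Rightarrow> real) \<Rightarrow> (nat \<Rightarrow> real)
    \<Rightarrow> real \<Rightarrow> nat \<Rightarrow> real \<Rightarrow> (real^'n \<Rightarrow> real) \<Rightarrow> (real^'n \<Rightarrow> real)
    \<Rightarrow> (nat \<Rightarrow> nat) \<Rightarrow> (nat \<Rightarrow> real^'n) \<Rightarrow> bool" where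
  "cgd N m U L \<eta> H\<psi> p L\<psi> f \<psi> i x \<longleftrightarrow>
     (let run = cgd_steps m U L \<eta> (\<lambda>y. f y + \<psi> y) i x in
      block_hessian_growth N m U H\<psi> p \<psi> \<and> lipschitz_hessian L\<psi> \<psi> \<and> run (cgd_rule1 H\<psi> p L\<psi>) \<or>
      block_hessian_growth N m U H\<psi> p \<psi> \<and> run (cgd_rule2 H\<psi> p) \<or>
      lipschitz_hessian L\<psi> \<psi> \<and> run (cgd_rule3 L\<psi> \<psi> (x 0)) \<or>
      block_upper_linear N m U \<psi> \<and> run (\<lambda>_ h _. cgd_rule4 h))"

end

theory Submission
  imports Defs
begin

text \<open>
  Convexity and the Cauchy-Schwarz inequality bound the gap \<open>\<Delta>\<close> at an iterate by \<open>\<parallel>\<nabla>F\<parallel> R\<close>, so the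
  assumed decrease over one cycle becomes \<open>\<Delta>\<^sub>k - \<Delta>\<^sub>k\<^sub>+\<^sub>1 \<ge> C \<Delta>\<^sub>k\<^sup>2 / R\<^sup>2\<close>. A sequence with this property
  satisfies \<open>1 / \<Delta>\<^sub>k\<^sub>+\<^sub>1 \<ge> 1 / \<Delta>\<^sub>k + C / R\<^sup>2\<close>, and summing gives the bound.
\<close>

text \<open>Restricting \<open>F\<close> to the line through \<open>x\<close> and \<open>y\<close>
  gives a convex function \<open>g\<close> of one real variable with \<open>g 0 = F x\<close>,
  \<open>g 1 = F y\<close> and slope \<open>(y - x) \<bullet> D\<close> at 0, so the one-dimensional
  tangent inequality applies.\<close>

lemma convex_on_above_gderiv:
  fixes F :: "'a::real_inner \<Rightarrow> real"
  assumes "convex_on UNIV F" and "GDERIV F x :> D"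
  shows "F x + (y - x) \<bullet> D \<le> F y"
proof -
  define g where "g t = F (x + t *\<^sub>R (y - x))" for t :: real
  have "convex_on UNIV g"
  proof (rule convex_onI)
    fix t u v :: real
    assume "0 < t" "t < 1"
    have "x + ((1 - t) * u + t * v) *\<^sub>R (y - x)
        = (1 - t) *\<^sub>R (x + u *\<^sub>R (y - x)) + t *\<^sub>R (x + v *\<^sub>R (y - x))"
      by (simp add: algebra_simps)
    then show "g ((1 - t) *\<^sub>R u + t *\<^sub>R v) \<le> (1 - t) * g u + t * g v"
      using convex_onD[OF assms(1), of t "x + u *\<^sub>R (y - x)" "x + v *\<^sub>R (y - x)"]
        \<open>0 < t\<close> \<open>t < 1\<close> by (simp add: g_def)
  qed simp
  moreover have "(g has_real_derivative (y - x) \<bullet> D) (at 0)"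
  proof -
    have "((\<lambda>t. x + t *\<^sub>R (y - x)) has_derivative (\<lambda>t. t *\<^sub>R (y - x))) (at 0)"
      by (auto intro!: derivative_eq_intros)
    moreover have "(F has_derivative (\<lambda>h. h \<bullet> D)) (at (x + 0 *\<^sub>R (y - x)))"
      using assms(2) by (simp add: gderiv_def)
    ultimately have "(g has_derivative (\<lambda>t. (t *\<^sub>R (y - x)) \<bullet> D)) (at 0)"
      unfolding g_def by (rule has_derivative_compose)
    then show ?thesis
      by (simp add: has_field_derivative_def mult_commute_abs)
  qed
  ultimately have "(y - x) \<bullet> D * (1 - 0) \<le> g 1 - g 0"
    by (intro convex_on_imp_above_tangent[where A = UNIV]) auto
  then show ?thesis
    by (simp add: g_def)
qed

text \<open>Telescoping the increments of \<open>1 / a n\<close>, each at least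
  \<open>C / S\<close>, with denominators cleared so that vanishing terms are covered too. In the
  application \<open>a\<close> is the gap after \<open>n\<close> cycles and \<open>S\<close> is
  \<open>R\<^sup>2\<close>.\<close>

lemma quadratic_decrease_rate:
  fixes a :: "nat \<Rightarrow> real"
  assumes "C \<ge> 0" and "S > 0" and nonneg: "\<And>n. a n \<ge> 0"
    and step: "\<And>n. C * (a n)\<^sup>2 \<le> S * (a n - a (Suc n))"
  shows "a n * (C * a 0 * real n + S) \<le> a 0 * S"
proof (induction n)
  case 0
  then show ?case by simp
next
  case (Suc n)
  have "0 \<le> S * (a n - a (Suc n))"
    using step[of n] \<open>C \<ge> 0\<close> by (smt (verit) mult_nonneg_nonneg zero_le_power2)
  then have mono: "a (Suc n) \<le> a n"
    using \<open>S > 0\<close> by (simp add: zero_le_mult_iff)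
  show ?case
  proof (cases "a n = 0")
    case True
    then show ?thesis
      using mono nonneg[of "Suc n"] nonneg[of 0] \<open>S > 0\<close> by simp
  next
    case False
    then have "a n > 0"
      using nonneg[of n] by simp
    \<comment> \<open>Trading one factor \<open>a n\<close> for the smaller \<open>a (Suc n)\<close>
      turns \<open>step\<close> into the increment bound for the reciprocals, multiplied through by
      \<open>S * a n * a (Suc n)\<close>.\<close>
    have "C * (a n * a (Suc n)) \<le> C * (a n)\<^sup>2"
      using mono \<open>C \<ge> 0\<close> nonneg[of n] by (simp add: mult_left_mono power2_eq_square)
    then have "a 0 * (C * (a n * a (Suc n))) \<le> a 0 * (S * (a n - a (Suc n)))"
      using step[of n] nonneg[of 0] by (intro mult_left_mono) auto
    moreover have "a (Suc n) * (a n * (C * a 0 * real n + S)) \<le> a (Suc n) * (a 0 * S)"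
      using Suc.IH nonneg[of "Suc n"] by (rule mult_left_mono)
    \<comment> \<open>Adding the two inequalities cancels \<open>a 0 * S * a (Suc n)\<close> on the
      right.\<close>
    ultimately have "a n * (a (Suc n) * (C * a 0 * real (Suc n) + S)) \<le> a n * (a 0 * S)"
      by (simp add: algebra_simps)
    then show ?thesis
      using \<open>a n > 0\<close> by simp
  qed
qed

theorem theorem7p3:
  fixes f \<psi> F :: "real^'n \<Rightarrow> real"
    and N p :: nat and m :: "nat \<Rightarrow> nat"
    and U :: "nat \<Rightarrow> nat \<Rightarrow> real^'n"
    and L \<eta> :: "nat \<Rightarrow> real"
    and H\<psi> L\<psi> C R :: real
    and x :: "nat \<Rightarrow> real^'n"
  assumes F_def: "F = (\<lambda>y. f y + \<psi> y)"
    and blocks: "identity_blocks N m U"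
    and f_diff: "\<forall>y. f differentiable (at y)"
    and A1: "block_lipschitz_grad N m U L f"
    and A2: "twice_cont_differentiable \<psi>"
    and A3: "minimizers F \<noteq> {}"
    and eta_pos: "\<forall>i\<in>{1..N}. \<eta> i > 0"
    and alg: "cpg N m U L \<eta> f \<psi> (cyclic_index N) x \<or>
              cgd N m U L \<eta> H\<psi> p L\<psi> f \<psi> (cyclic_index N) x"
    and C_pos: "C > 0"
    and descent: "\<forall>k. F (x k) - F (x (k + N)) \<ge> C * (norm (grad F (x k)))^2"
    and F_convex: "convex_on UNIV F"
    and R_finite: "bdd_above (range (\<lambda>k. infdist (x k) (minimizers F)))"
    and R_eq: "R = (SUP k. infdist (x k) (minimizers F))"
  shows "\<forall>k. \<forall>xs\<in>minimizers F.
           F (x (k * N)) - F xs \<le> (F (x 0) - F xs) * R^2 / (C * (F (x 0) - F xs) * real k + R^2)"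
proof (intro allI ballI)
  fix k xs
  assume xs: "xs \<in> minimizers F"
  have min: "F z \<le> F y" if "z \<in> minimizers F" for y z
    using that by (auto simp: minimizers_def is_arg_min_linorder)
  have infdist_le: "infdist (x n) (minimizers F) \<le> R" for n
    unfolding R_eq using R_finite by (intro cSUP_upper) simp_all
  then have "R \<ge> 0"
    using infdist_nonneg[of "x 0" "minimizers F"] by (meson order_trans)
  have "F differentiable (at y)" for y
    using f_diff A2 unfolding F_def twice_cont_differentiable_def
    by (simp add: differentiable_add)
  then have gderiv: "GDERIV F y :> grad F y" for y
    by (rule grad_GDERIV)
  have gap: "F (x n) - F xs \<le> norm (grad F (x n)) * R" for n
  proof -
    let ?g = "norm (grad F (x n))"
    \<comment> \<open>All minimizers share one value, so the gap to \<open>xs\<close> can be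
      measured by the distance to any minimizer \<open>z\<close>.\<close>
    have "F (x n) - F xs \<le> ?g * dist (x n) z" if "z \<in> minimizers F" for z
    proof -
      have "F (x n) - F z \<le> (x n - z) \<bullet> grad F (x n)"
        using convex_on_above_gderiv[OF F_convex gderiv, of "x n" z]
        by (simp add: inner_diff_left)
      also have "\<dots> \<le> ?g * dist (x n) z"
        by (metis norm_cauchy_schwarz mult.commute dist_norm)
      finally show ?thesis
        using min[OF that, of xs] min[OF xs, of z] by simp
    qed
    note le = this
    \<comment> \<open>Dividing by \<open>?g\<close> allows passing to the infimum over
      \<open>z\<close>, so no nearest minimizer has to be chosen; if \<open>?g = 0\<close>, the gap
      is already at most 0.\<close>
    have "F (x n) - F xs \<le> ?g * infdist (x n) (minimizers F)"
    proof (cases "?g = 0")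
      case True
      then show ?thesis using le[OF xs] by simp
    next
      case False
      then have "(F (x n) - F xs) / ?g \<le> infdist (x n) (minimizers F)"
        unfolding infdist_notempty[OF A3] using A3 le
        by (intro cINF_greatest) (simp_all add: pos_divide_le_eq mult.commute)
      then show ?thesis
        using False by (simp add: field_simps)
    qed
    also have "\<dots> \<le> ?g * R"
      by (intro mult_left_mono infdist_le) simp
    finally show ?thesis .
  qed
  define a where "a n = F (x (n * N)) - F xs" for n
  have nonneg: "a n \<ge> 0" for n
    using min[OF xs] by (simp add: a_def)
  have step: "C * (a n)\<^sup>2 \<le> R\<^sup>2 * (a n - a (Suc n))" for n
  proof -
    have "(a n)\<^sup>2 \<le> (norm (grad F (x (n * N))) * R)\<^sup>2"
      using gap[of "n * N"] nonneg[of n] by (intro power_mono) (simp_all add: a_def)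
    then have "C * (a n)\<^sup>2 \<le> R\<^sup>2 * (C * (norm (grad F (x (n * N))))\<^sup>2)"
      using C_pos by (simp add: power_mult_distrib mult_ac)
    \<comment> \<open>One cycle leads from index \<open>n * N\<close> to
      \<open>n * N + N = Suc n * N\<close>.\<close>
    also have "\<dots> \<le> R\<^sup>2 * (a n - a (Suc n))"
      using descent[rule_format, of "n * N"]
      by (intro mult_left_mono) (simp_all add: a_def add.commute)
    finally show ?thesis .
  qed
  have "a k \<le> a 0 * R\<^sup>2 / (C * a 0 * real k + R\<^sup>2)"
  \<comment> \<open>For \<open>R = 0\<close> the numerator is 0, hence so is the quotient, even if
    the denominator vanishes; \<open>gap\<close> then gives \<open>a k \<le> 0\<close>.\<close>
  proof (cases "R = 0")
    case True
    then show ?thesis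
      using gap[of "k * N"] by (simp add: a_def)
  next
    case False
    then have "C * a 0 * real k + R\<^sup>2 > 0"
      using C_pos nonneg[of 0] by (intro add_nonneg_pos) simp_all
    moreover have "a k * (C * a 0 * real k + R\<^sup>2) \<le> a 0 * R\<^sup>2"
      using C_pos False nonneg step by (intro quadratic_decrease_rate) simp_all
    ultimately show ?thesis
      by (simp add: pos_le_divide_eq)
  qed
  then show "F (x (k * N)) - F xs
      \<le> (F (x 0) - F xs) * R^2 / (C * (F (x 0) - F xs) * real k + R^2)"
    by (simp add: a_def)
qed

end
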